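(* Let $G$ be an algebraic group over an algebraically closed field $\mathbb{K}$ of characteristic $p>0$, and let $k\geq 1$ be an integer. If $\delta\in \mathrm{Dist}_{k}^{+}(G)$, then the $p$-th power $\delta^p$, computed in the distribution algebra $\mathrm{Dist}(G)$, lies in $\mathrm{Dist}_{pk-1}^{+}(G)$.
   Context: $\mathbb{K}[G]$ is the coordinate (Hopf) algebra of the affine algebraic group $G$, with comultiplication $\Delta$, and $I_1=\{f\in\mathbb{K}[G] : f(1)=0\}$ is the ideal of functions vanishing at the identity. For $k\ge 0$, $\mathrm{Dist}_k(G)$ is the space of linear maps $\mu:\mathbb{K}[G]\to\mathbb{K}$ with $\mu(I_1^{k+1})=0$, and $\mathrm{Dist}_k^{+}(G)=\{\mu\in\mathrm{Dist}_k(G): \mu(1)=0\}$ (here $1\in\mathbb{K}[G]$ is the constant function). $\mathrm{Dist}(G)=\bigcup_{k\ge0}\mathrm{Dist}_k(G)$ is an algebra with product $\mu\rho=(\mu\otimes\rho)\circ\Delta$. *)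

theory Defs
  imports
    "HOL-Library.Multiset"
    "HOL-Computational_Algebra.Polynomial"
    "HOL-Algebra.Ring"
begin

section \<open>Tensors\<close>

text \<open>
  A tensor \<open>a\<^sub>1 \<otimes> b\<^sub>1 + \<dots> + a\<^sub>n \<otimes> b\<^sub>n\<close> is written as the formal sum
  \<open>{#(a\<^sub>1, b\<^sub>1), \<dots>, (a\<^sub>n, b\<^sub>n)#}\<close>, and \<open>A \<otimes> A\<close> is the quotient of the commutative monoid of
  formal sums by the congruence generated by the bilinearity relations. Scalars of formal sums
  are absorbed into the tensor factors, and the quotient is a group because
  \<open>(- a) \<otimes> b\<close> is inverse to \<open>a \<otimes> b\<close>. The same is done for \<open>A \<otimes> A \<otimes> A\<close>.
  Equations in a tensor power are stated as congruences between representatives.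
\<close>

inductive cong_closure ::
  "('x multiset \<Rightarrow> 'x multiset \<Rightarrow> bool) \<Rightarrow> 'x multiset \<Rightarrow> 'x multiset \<Rightarrow> bool"
  for R where
  gen: "R M N \<Longrightarrow> cong_closure R M N"
| refl: "cong_closure R M M"
| sym: "cong_closure R M N \<Longrightarrow> cong_closure R N M"
| trans: "cong_closure R L M \<Longrightarrow> cong_closure R M N \<Longrightarrow> cong_closure R L N"
| add: "cong_closure R M N \<Longrightarrow> cong_closure R (M + L) (N + L)"

inductive bilinear_rel ::
  "('k \<Rightarrow> 'a::ab_group_add \<Rightarrow> 'a) \<Rightarrow> ('a \<times> 'a) multiset \<Rightarrow> ('a \<times> 'a) multiset \<Rightarrow> bool"
  for s where
  "bilinear_rel s {#(a + a', b)#} {#(a, b), (a', b)#}"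
| "bilinear_rel s {#(a, b + b')#} {#(a, b), (a, b')#}"
| "bilinear_rel s {#(s c a, b)#} {#(a, s c b)#}"
| "bilinear_rel s {#(0, b)#} {#}"

inductive trilinear_rel ::
  "('k \<Rightarrow> 'a::ab_group_add \<Rightarrow> 'a)
    \<Rightarrow> ('a \<times> 'a \<times> 'a) multiset \<Rightarrow> ('a \<times> 'a \<times> 'a) multiset \<Rightarrow> bool"
  for s where
  "trilinear_rel s {#(a + a', b, c)#} {#(a, b, c), (a', b, c)#}"
| "trilinear_rel s {#(a, b + b', c)#} {#(a, b, c), (a, b', c)#}"
| "trilinear_rel s {#(a, b, c + c')#} {#(a, b, c), (a, b, c')#}"
| "trilinear_rel s {#(s x a, b, c)#} {#(a, s x b, c)#}"
| "trilinear_rel s {#(a, s x b, c)#} {#(a, b, s x c)#}"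
| "trilinear_rel s {#(0, b, c)#} {#}"

abbreviation tensor_eq where "tensor_eq s \<equiv> cong_closure (bilinear_rel s)"

abbreviation tensor3_eq where "tensor3_eq s \<equiv> cong_closure (trilinear_rel s)"

definition tensor_times ::
  "('a::comm_ring_1 \<times> 'a) multiset \<Rightarrow> ('a \<times> 'a) multiset \<Rightarrow> ('a \<times> 'a) multiset" where
  "tensor_times M N = (\<Sum>(a, b)\<in>#M. \<Sum>(c, d)\<in>#N. {#(a * c, b * d)#})"

text \<open>The map \<open>\<mu> \<otimes> \<rho>\<close>, with values in \<open>K \<otimes> K = K\<close>.\<close>

definition tensor_map ::
  "('a \<Rightarrow> 'k::field) \<Rightarrow> ('a \<Rightarrow> 'k) \<Rightarrow> ('a \<times> 'a) multiset \<Rightarrow> 'k" where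
  "tensor_map \<mu> \<rho> M = (\<Sum>(a, b)\<in>#M. \<mu> a * \<rho> b)"

lemma tensor_map_well_defined:
  fixes s :: "'k::field \<Rightarrow> 'a::ab_group_add \<Rightarrow> 'a"
  assumes "Vector_Spaces.linear s (*) \<mu>" and "Vector_Spaces.linear s (*) \<rho>"
    and "tensor_eq s M N"
  shows "tensor_map \<mu> \<rho> M = tensor_map \<mu> \<rho> N"
proof -
  interpret m: Vector_Spaces.linear s "(*)" \<mu> by fact
  interpret r: Vector_Spaces.linear s "(*)" \<rho> by fact
  have "tensor_map \<mu> \<rho> M = tensor_map \<mu> \<rho> N" if "bilinear_rel s M N" for M N
    using that
    by cases (simp_all only: tensor_map_def image_mset_add_mset image_mset_empty sum_mset.add_mset
        sum_mset.empty case_prod_conv m.add r.add m.scale r.scale m.zero mult_zero_left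
        distrib_left distrib_right mult_ac add_0_left add_0_right)
  with assms(3) show ?thesis
    by (induction rule: cong_closure.induct) (simp_all add: tensor_map_def)
qed

section \<open>Affine algebraic groups\<close>

text \<open>
  An affine algebraic group \<open>G\<close> over \<open>K\<close> is given by its coordinate algebra, a finitely
  generated commutative Hopf algebra \<open>K[G]\<close> whose underlying ring is the type \<open>'a\<close>. No
  reducedness is required, so linear algebraic groups in the sense of varieties and affine group
  schemes of finite type are both covered. The value \<open>comult G f\<close> is a representative of the
  tensor \<open>\<Delta>(f)\<close>.
\<close>

record ('k, 'a) coordinate_algebra =
  scalar :: "'k \<Rightarrow> 'a \<Rightarrow> 'a"
  comult :: "'a \<Rightarrow> ('a \<times> 'a) multiset"
  counit :: "'a \<Rightarrow> 'k"
  antipode :: "'a \<Rightarrow> 'a"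

definition subalgebra :: "('k, 'a::comm_ring_1) coordinate_algebra \<Rightarrow> 'a set \<Rightarrow> bool" where
  "subalgebra G S \<longleftrightarrow>
    1 \<in> S \<and> (\<forall>f\<in>S. \<forall>g\<in>S. f + g \<in> S \<and> f * g \<in> S) \<and> (\<forall>c. \<forall>f\<in>S. scalar G c f \<in> S)"

locale affine_algebraic_group =
  fixes G :: "('k::field, 'a::comm_ring_1) coordinate_algebra"
  assumes vector_space: "vector_space (scalar G)"
    and scalar_mult: "scalar G c (f * g) = scalar G c f * g"
    and finitely_generated: "\<exists>X. finite X \<and> subalgebra G hull X = UNIV"
    and counit_linear: "Vector_Spaces.linear (scalar G) (*) (counit G)"
    and counit_mult: "counit G (f * g) = counit G f * counit G g"
    and counit_one: "counit G 1 = 1"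
    and comult_add: "tensor_eq (scalar G) (comult G (f + g)) (comult G f + comult G g)"
    and comult_scalar:
      "tensor_eq (scalar G) (comult G (scalar G c f)) (\<Sum>(a, b)\<in>#comult G f. {#(scalar G c a, b)#})"
    and comult_mult:
      "tensor_eq (scalar G) (comult G (f * g)) (tensor_times (comult G f) (comult G g))"
    and comult_one: "tensor_eq (scalar G) (comult G 1) {#(1, 1)#}"
    and coassoc:
      "tensor3_eq (scalar G)
        (\<Sum>(a, b)\<in>#comult G f. \<Sum>(a1, a2)\<in>#comult G a. {#(a1, a2, b)#})
        (\<Sum>(a, b)\<in>#comult G f. \<Sum>(b1, b2)\<in>#comult G b. {#(a, b1, b2)#})"
    and counit_left: "(\<Sum>(a, b)\<in>#comult G f. scalar G (counit G a) b) = f"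
    and counit_right: "(\<Sum>(a, b)\<in>#comult G f. scalar G (counit G b) a) = f"
    and antipode_linear: "Vector_Spaces.linear (scalar G) (scalar G) (antipode G)"
    and antipode_left: "(\<Sum>(a, b)\<in>#comult G f. antipode G a * b) = scalar G (counit G f) 1"
    and antipode_right: "(\<Sum>(a, b)\<in>#comult G f. a * antipode G b) = scalar G (counit G f) 1"

section \<open>The distribution algebra\<close>

text \<open>
  Points of \<open>G\<close> over \<open>K\<close> are the algebra homomorphisms \<open>x: K[G] \<rightarrow> K\<close>, with \<open>f(x) = x f\<close>.
  The identity point is the counit, so \<open>f(1)\<close> is \<open>counit G f\<close>.
\<close>

definition ideal_at_identity :: "('k::zero, 'a) coordinate_algebra \<Rightarrow> 'a set" where
  "ideal_at_identity G = {f. counit G f = 0}"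

text \<open>The span over the ring \<open>'a\<close> itself is the generated ideal.\<close>

primrec ideal_power :: "'a::comm_ring_1 set \<Rightarrow> nat \<Rightarrow> 'a set" where
  "ideal_power I 0 = UNIV"
| "ideal_power I (Suc n) = module.span (*) {f * g | f g. f \<in> I \<and> g \<in> ideal_power I n}"

definition Dist :: "('k::field, 'a::comm_ring_1) coordinate_algebra \<Rightarrow> nat \<Rightarrow> ('a \<Rightarrow> 'k) set" where
  "Dist G k = {\<mu>. Vector_Spaces.linear (scalar G) (*) \<mu> \<and>
    (\<forall>f\<in>ideal_power (ideal_at_identity G) (k + 1). \<mu> f = 0)}"

definition Dist_plus ::
  "('k::field, 'a::comm_ring_1) coordinate_algebra \<Rightarrow> nat \<Rightarrow> ('a \<Rightarrow> 'k) set" where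
  "Dist_plus G k = {\<mu> \<in> Dist G k. \<mu> 1 = 0}"

definition Dist_algebra ::
  "('k::field, 'a::comm_ring_1) coordinate_algebra \<Rightarrow> ('a \<Rightarrow> 'k) ring" where
  "Dist_algebra G =
    \<lparr> carrier = (\<Union>k. Dist G k),
      mult = (\<lambda>\<mu> \<rho> f. tensor_map \<mu> \<rho> (comult G f)),
      one = counit G,
      zero = (\<lambda>f. 0),
      add = (\<lambda>\<mu> \<rho> f. \<mu> f + \<rho> f) \<rparr>"

end

theory Submission
  imports Defs
begin

text \<open>
  A linear form \<open>\<mu>\<close> on \<open>K[G]\<close> acts on \<open>K[G]\<close> by \<open>T\<^sub>\<mu> = (id \<otimes> \<mu>) \<circ> \<Delta>\<close>, and the powers of \<open>\<mu>\<close> in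
  the distribution algebra are \<open>\<mu>\<^sup>n = \<epsilon> \<circ> T\<^sub>\<mu>\<^sup>n\<close>. If \<open>\<mu>\<close> vanishes on \<open>I\<^sub>1\<close> to the power \<open>k + 1\<close>, then \<open>T\<^sub>\<mu>\<close> is
  a differential operator of order at most \<open>k\<close> in the sense of Grothendieck. For such an
  operator \<open>D\<close> and a function \<open>f\<close>, commuting \<open>[D, f]\<close> past powers of \<open>D\<close> lowers the order, so
  \<open>[D\<^sup>p, f]\<close> agrees with \<open>p D\<^sup>p\<^sup>-\<^sup>1 [D, f]\<close>, which is zero in characteristic \<open>p\<close>, up to order
  \<open>pk - 2\<close>. Hence \<open>D\<^sup>p\<close> has order at most \<open>pk - 1\<close>, and \<open>\<epsilon> \<circ> D\<^sup>p\<close> vanishes on \<open>I\<^sub>1\<close> to the power \<open>pk\<close>.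
\<close>

section \<open>Differential operators on a commutative ring\<close>

definition commutator :: "('a::ab_group_add \<Rightarrow> 'a) \<Rightarrow> ('a \<Rightarrow> 'a) \<Rightarrow> 'a \<Rightarrow> 'a" where
  "commutator P Q = (\<lambda>x. P (Q x) - Q (P x))"

text \<open>The order is strictly less than the index, so that index \<open>0\<close> is the zero operator.\<close>

primrec diff_op :: "nat \<Rightarrow> ('a::comm_ring_1 \<Rightarrow> 'a) \<Rightarrow> bool" where
  "diff_op 0 P \<longleftrightarrow> P = (\<lambda>x. 0)"
| "diff_op (Suc n) P \<longleftrightarrow> additive P \<and> (\<forall>f. diff_op n (commutator P ((*) f)))"

section \<open>Closure properties of differential operators\<close>

lemma diff_op_additive: "diff_op n P \<Longrightarrow> additive P"
  by (cases n) (auto intro: additive.intro)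

lemma diff_op_zero: "diff_op n (\<lambda>x. 0)"
  by (induction n) (auto intro: additive.intro simp: commutator_def)

lemma diff_op_add:
  assumes "diff_op n P" "diff_op n Q" shows "diff_op n (\<lambda>x. P x + Q x)"
  using assms
proof (induction n arbitrary: P Q)
  case (Suc n)
  have "commutator (\<lambda>x. P x + Q x) ((*) f)
      = (\<lambda>x. commutator P ((*) f) x + commutator Q ((*) f) x)" for f
    by (simp add: commutator_def fun_eq_iff algebra_simps)
  with Suc show ?case
    by (auto intro!: additive.intro simp: additive.add algebra_simps)
qed auto

lemma diff_op_mult_left:
  assumes "diff_op n P" shows "diff_op n (\<lambda>x. a * P x)"
  using assms
proof (induction n arbitrary: P)
  case (Suc n)
  have "commutator (\<lambda>x. a * P x) ((*) f) = (\<lambda>x. a * commutator P ((*) f) x)" for f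
    by (simp add: commutator_def fun_eq_iff algebra_simps)
  with Suc show ?case
    by (auto intro!: additive.intro simp: additive.add algebra_simps)
qed auto

lemma diff_op_mult_right:
  assumes "diff_op n P" shows "diff_op n (\<lambda>x. P (a * x))"
  using assms
proof (induction n arbitrary: P)
  case (Suc n)
  have "commutator (\<lambda>x. P (a * x)) ((*) f) = (\<lambda>x. commutator P ((*) f) (a * x))" for f
    by (simp add: commutator_def fun_eq_iff algebra_simps)
  with Suc show ?case
    by (auto intro!: additive.intro simp: additive.add algebra_simps)
qed auto

lemma diff_op_sum_mset:
  assumes "\<And>i. i \<in># M \<Longrightarrow> diff_op n (P i)"
  shows "diff_op n (\<lambda>x. \<Sum>i\<in>#M. P i x)"
  using assms by (induction M) (auto intro: diff_op_zero diff_op_add)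

text \<open>Orders add under composition; in terms of indices, (m - 1) + (n - 1) + 1 = m + n - 1.
  The induction uses the Leibniz rule [PQ, f] = P [Q, f] + [P, f] Q.\<close>

lemma diff_op_compose:
  assumes "diff_op m P" "diff_op n Q"
  shows "diff_op (m + n - 1) (P \<circ> Q)"
  using assms
proof (induction "m + n" arbitrary: m n P Q)
  case (Suc r)
  note addP = diff_op_additive[OF Suc.prems(1)] and addQ = diff_op_additive[OF Suc.prems(2)]
  show ?case
  proof (cases "m = 0 \<or> n = 0")
    case True
    with Suc.prems additive.zero[OF addP] have "P \<circ> Q = (\<lambda>x. 0)"
      by (auto simp: fun_eq_iff)
    then show ?thesis by (simp add: diff_op_zero)
  next
    case False
    then obtain m' n' where mn: "m = Suc m'" "n = Suc n'"
      by (meson not0_implies_Suc)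
    have "diff_op (m' + n') (commutator (P \<circ> Q) ((*) f))" for f
    proof -
      have "commutator (P \<circ> Q) ((*) f)
          = (\<lambda>x. (P \<circ> commutator Q ((*) f)) x + (commutator P ((*) f) \<circ> Q) x)"
        by (simp add: commutator_def fun_eq_iff additive.diff[OF addP])
      moreover have "diff_op (m' + n') (P \<circ> commutator Q ((*) f))"
        using Suc.hyps(1)[of m n' P "commutator Q ((*) f)"] Suc.prems Suc.hyps(2) mn by simp
      moreover have "diff_op (m' + n') (commutator P ((*) f) \<circ> Q)"
        using Suc.hyps(1)[of m' n "commutator P ((*) f)" Q] Suc.prems Suc.hyps(2) mn by simp
      ultimately show ?thesis by (simp only: diff_op_add)
    qed
    then show ?thesis
      using mn addP addQ by (auto intro!: additive.intro simp: additive.add)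
  qed
qed (simp add: fun_eq_iff)

text \<open>The Jacobi identity passes the claim to [P, f] and [Q, f]. The gain of one order over
  the composition comes from order zero, where all operators commute.\<close>

lemma diff_op_commutator:
  assumes "diff_op m P" "diff_op n Q"
  shows "diff_op (m + n - 2) (commutator P Q)"
  using assms
proof (induction "m + n" arbitrary: m n P Q)
  case (Suc r)
  note addP = diff_op_additive[OF Suc.prems(1)] and addQ = diff_op_additive[OF Suc.prems(2)]
  show ?case
  proof (cases "m = 0 \<or> n = 0")
    case True
    with Suc.prems additive.zero[OF addP] additive.zero[OF addQ]
    have "commutator P Q = (\<lambda>x. 0)"
      by (auto simp: fun_eq_iff commutator_def)
    then show ?thesis by (simp add: diff_op_zero)
  next
    case False
    then obtain m' n' where mn: "m = Suc m'" "n = Suc n'"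
      by (meson not0_implies_Suc)
    show ?thesis
    proof (cases "m' + n'")
      case 0
      \<comment> \<open>Both indices are 1, so P and Q commute with all multiplications and are
        themselves multiplications, by their values at 1.\<close>
      with Suc.prems mn have "P (f * x) = f * P x" "Q (f * x) = f * Q x" for f x
        by (auto simp: commutator_def fun_eq_iff)
      then have "P x = x * P 1" "Q x = x * Q 1" for x
        by (metis mult.right_neutral)+
      then have "P (Q x) = Q (P x)" for x
        by (metis mult.assoc mult.commute)
      then have "commutator P Q = (\<lambda>x. 0)"
        by (simp add: commutator_def fun_eq_iff)
      then show ?thesis by (simp add: diff_op_zero)
    next
      case (Suc s)
      have "diff_op s (commutator (commutator P Q) ((*) f))" for f
      proof -
        have "commutator (commutator P Q) ((*) f)
          = (\<lambda>x. commutator (commutator P ((*) f)) Q x + commutator P (commutator Q ((*) f)) x)"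
          by (simp add: commutator_def fun_eq_iff additive.diff[OF addP] additive.diff[OF addQ]
              algebra_simps)
        moreover have "diff_op s (commutator P (commutator Q ((*) f)))"
          using Suc.hyps(1)[of m n' P "commutator Q ((*) f)"] Suc.prems Suc.hyps(2) mn Suc by simp
        moreover have "diff_op s (commutator (commutator P ((*) f)) Q)"
          using Suc.hyps(1)[of m' n "commutator P ((*) f)" Q] Suc.prems Suc.hyps(2) mn Suc by simp
        ultimately show ?thesis by (simp only: diff_op_add)
      qed
      then show ?thesis
        using mn Suc addP addQ
        by (auto intro!: additive.intro simp: additive.add commutator_def)
    qed
  qed
qed (simp add: commutator_def)

section \<open>Powers of a differential operator\<close>

lemma diff_op_funpow:
  assumes "diff_op (Suc k) D" shows "diff_op (Suc (n * k)) (D ^^ n)"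
proof (induction n)
  case 0
  then show ?case by (auto intro: additive.intro simp: commutator_def)
next
  case (Suc n)
  from diff_op_compose[OF assms Suc] show ?case by (simp del: diff_op.simps add: comp_def)
qed

text \<open>[D^(n+1), f] is the sum of the D^i E D^(n-i) with E = [D, f]. Moving E to the right end
  of each term costs a commutator [E, D], which lies one order below the leading term (n+1) D^n
  E.\<close>

lemma diff_op_commutator_funpow:
  fixes D :: "'a::comm_ring_1 \<Rightarrow> 'a"
  assumes D: "diff_op (Suc k) D" and k: "k \<ge> 1"
  shows "diff_op (Suc n * k - 1)
    (\<lambda>x. commutator (D ^^ Suc n) ((*) f) x - of_nat (Suc n) * (D ^^ n) (commutator D ((*) f) x))"
proof (induction n)
  case 0
  then show ?case by (simp add: diff_op_zero)
next
  case (Suc n)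
  define E where "E = commutator D ((*) f)"
  define R where "R = (\<lambda>x. commutator (D ^^ Suc n) ((*) f) x - of_nat (Suc n) * (D ^^ n) (E x))"
  have E: "diff_op k E" using D by (simp add: E_def)
  have R: "diff_op (Suc n * k - 1) R" using Suc by (simp only: R_def E_def)
  have addn: "additive (D ^^ m)" for m
    using diff_op_additive[OF diff_op_funpow[OF D]] .
  have swap: "(D ^^ m) (D x) = D ((D ^^ m) x)" for m x
    by (simp add: funpow_swap1)
  \<comment> \<open>This follows from [D^(n+2), f] = [D^(n+1), f] D + D^(n+1) E, trading D^n E D for
    D^(n+1) E + D^n [E, D].\<close>
  have "commutator (D ^^ Suc (Suc n)) ((*) f) x - of_nat (Suc (Suc n)) * (D ^^ Suc n) (E x)
      = (R \<circ> D) x + of_nat (Suc n) * ((D ^^ n) \<circ> commutator E D) x" for x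
  proof -
    have a: "(D ^^ n) (commutator E D x) = (D ^^ n) (E (D x)) - D ((D ^^ n) (E x))"
      by (simp add: commutator_def additive.diff[OF addn] swap)
    have b: "D (D ((D ^^ n) (f * x))) = D ((D ^^ n) (E x)) + D ((D ^^ n) (f * D x))"
      by (simp add: E_def commutator_def additive.diff[OF addn] swap
          additive.diff[OF diff_op_additive[OF D]])
    show ?thesis
      by (simp add: R_def commutator_def[of _ "(*) f"] swap a b algebra_simps)
  qed
  moreover have "diff_op (Suc (Suc n) * k - 1) (R \<circ> D)"
    using diff_op_compose[OF R D] k by (simp add: algebra_simps)
  moreover have "diff_op (Suc (Suc n) * k - 1) ((D ^^ n) \<circ> commutator E D)"
    using diff_op_compose[OF diff_op_funpow[OF D, of n] diff_op_commutator[OF E D]] k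
    by (simp add: algebra_simps)
  ultimately show ?case
    unfolding E_def[symmetric] by (simp only: diff_op_add diff_op_mult_left)
qed

text \<open>For n + 1 = p the leading term disappears, so every [D^p, f] has index pk - 1. This
  improves the index pk + 1 from \<open>diff_op_funpow\<close> by one.\<close>

lemma diff_op_funpow_char:
  fixes D :: "'a::comm_ring_1 \<Rightarrow> 'a"
  assumes D: "diff_op (Suc k) D" and k: "k \<ge> 1" and p: "p > 0" "of_nat p = (0 :: 'a)"
  shows "diff_op (p * k) (D ^^ p)"
proof -
  obtain n where n: "p = Suc n" using p by (cases p) auto
  obtain m where m: "p * k = Suc m" using p k by (cases "p * k") auto
  have "diff_op m (commutator (D ^^ p) ((*) f))" for f
    using diff_op_commutator_funpow[OF D k, of n f] p(2) m
    unfolding n[symmetric] by simp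
  then show ?thesis
    using diff_op_additive[OF diff_op_funpow[OF D]] by (simp add: m)
qed

section \<open>Distributions as differential operators\<close>

lemma module_times: "module ((*) :: 'a::comm_ring_1 \<Rightarrow> 'a \<Rightarrow> 'a)"
  by unfold_locales (simp_all add: algebra_simps)

definition contract_right ::
  "('k, 'a::ab_group_add) coordinate_algebra \<Rightarrow> ('a \<Rightarrow> 'k) \<Rightarrow> ('a \<times> 'a) multiset \<Rightarrow> 'a" where
  "contract_right G \<mu> M = (\<Sum>(a, b)\<in>#M. scalar G (\<mu> b) a)"

text \<open>The operator \<open>T\<^sub>\<mu>\<close>, computed on the chosen representative of the
  coproduct.\<close>

definition dist_action ::
  "('k, 'a::ab_group_add) coordinate_algebra \<Rightarrow> ('a \<Rightarrow> 'k) \<Rightarrow> 'a \<Rightarrow> 'a" where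
  "dist_action G \<mu> f = contract_right G \<mu> (comult G f)"

lemma additive_sum_mset:
  "additive h \<Longrightarrow> h (\<Sum>x\<in>#M. g x) = (\<Sum>x\<in>#M. h (g x))"
  by (induction M) (simp_all add: additive.add additive.zero)

lemma sum_mset_subtractf:
  fixes g h :: "'b \<Rightarrow> 'c::ab_group_add"
  shows "(\<Sum>x\<in>#M. g x - h x) = (\<Sum>x\<in>#M. g x) - (\<Sum>x\<in>#M. h x)"
  by (induction M) simp_all

context affine_algebraic_group
begin

sublocale V: vector_space "scalar G"
  by (rule vector_space)

abbreviation linear_form :: "('a \<Rightarrow> 'k) \<Rightarrow> bool" where
  "linear_form \<mu> \<equiv> Vector_Spaces.linear (scalar G) (*) \<mu>"

lemma linear_form_iff:
  "linear_form \<mu> \<longleftrightarrow> (\<forall>f g. \<mu> (f + g) = \<mu> f + \<mu> g) \<and> (\<forall>c f. \<mu> (scalar G c f) = c * \<mu> f)"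
proof -
  have "vector_space ((*) :: 'k \<Rightarrow> 'k \<Rightarrow> 'k)"
    by unfold_locales (simp_all add: algebra_simps)
  with vector_space show ?thesis
    by (simp add: Vector_Spaces.linear_iff)
qed

lemma linear_form_additive: "linear_form \<mu> \<Longrightarrow> additive \<mu>"
  by (simp add: linear_form_iff additive.intro)

lemma linear_form_scalar: "linear_form \<mu> \<Longrightarrow> \<mu> (scalar G c f) = c * \<mu> f"
  by (simp add: linear_form_iff)

lemma scalar_mult_right: "f * scalar G c g = scalar G c (f * g)"
  using scalar_mult[of c g f] by (simp add: mult.commute)

lemma linear_form_translate: "linear_form \<mu> \<Longrightarrow> linear_form (\<lambda>x. \<mu> (b * x))"
  by (simp add: linear_form_iff distrib_left scalar_mult_right)

lemma additive_scalar: "additive (scalar G c)"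
  by (simp add: additive.intro V.scale_right_distrib)

text \<open>This lets the Hopf algebra axioms, which are congruences of formal sums, be applied
  under \<open>dist_action\<close>.\<close>

lemma contract_right_cong:
  assumes "linear_form \<mu>" and "tensor_eq (scalar G) M N"
  shows "contract_right G \<mu> M = contract_right G \<mu> N"
proof -
  have "contract_right G \<mu> M = contract_right G \<mu> N" if "bilinear_rel (scalar G) M N" for M N
    using that assms(1)
    by cases (auto simp: contract_right_def linear_form_iff V.scale_left_distrib
        V.scale_right_distrib mult.commute)
  with assms(2) show ?thesis
    by (induction rule: cong_closure.induct) (simp_all add: contract_right_def)
qed

lemma dist_action_add:
  "linear_form \<mu> \<Longrightarrow> dist_action G \<mu> (f + g) = dist_action G \<mu> f + dist_action G \<mu> g"
  unfolding dist_action_def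
  by (subst contract_right_cong[OF _ comult_add]) (simp_all add: contract_right_def)

lemma dist_action_scalar:
  "linear_form \<mu> \<Longrightarrow> dist_action G \<mu> (scalar G c f) = scalar G c (dist_action G \<mu> f)"
  unfolding dist_action_def
  by (subst contract_right_cong[OF _ comult_scalar])
    (auto simp: contract_right_def case_prod_unfold image_mset.compositionality comp_def
      V.scale_left_commute additive_sum_mset[OF additive_scalar] mult.commute)

lemma dist_action_one: "linear_form \<mu> \<Longrightarrow> dist_action G \<mu> 1 = scalar G (\<mu> 1) 1"
  unfolding dist_action_def
  by (subst contract_right_cong[OF _ comult_one]) (simp_all add: contract_right_def)

lemma dist_action_diff_form:
  "dist_action G (\<lambda>x. \<mu> x - c * \<rho> x) f = dist_action G \<mu> f - scalar G c (dist_action G \<rho> f)"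
  by (simp add: dist_action_def contract_right_def case_prod_unfold V.scale_left_diff_distrib
      sum_mset_subtractf additive_sum_mset[OF additive_scalar])

lemma dist_action_mult:
  assumes "linear_form \<mu>"
  shows "dist_action G \<mu> (f * g) = (\<Sum>(a, b)\<in>#comult G f. a * dist_action G (\<lambda>x. \<mu> (b * x)) g)"
proof -
  have *: "contract_right G \<mu> (\<Sum>x\<in>#M. h x) = (\<Sum>x\<in>#M. contract_right G \<mu> (h x))"
    for M and h :: "'a \<times> 'a \<Rightarrow> ('a \<times> 'a) multiset"
    by (induction M) (simp_all add: contract_right_def)
  show ?thesis
    unfolding dist_action_def contract_right_cong[OF assms comult_mult]
    by (simp add: tensor_times_def case_prod_unfold *)
      (simp add: contract_right_def case_prod_unfold sum_mset_distrib_left scalar_mult_right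
        image_mset.compositionality comp_def)
qed

text \<open>By the counit axiom f is the sum of the \<epsilon>(b) a, so subtracting f
  \<open>T\<^sub>\<mu>\<close> g replaces each b in the product formula by b - \<epsilon>(b), an
  element of the augmentation ideal.\<close>

lemma commutator_dist_action:
  assumes "linear_form \<mu>"
  shows "commutator (dist_action G \<mu>) ((*) f) =
    (\<lambda>g. \<Sum>(a, b)\<in>#comult G f.
      a * dist_action G (\<lambda>x. \<mu> ((b - scalar G (counit G b) 1) * x)) g)"
proof
  fix g
  have "f * dist_action G \<mu> g
      = (\<Sum>(a, b)\<in>#comult G f. a * scalar G (counit G b) (dist_action G \<mu> g))"
    by (subst (1) counit_right[of f, symmetric])
      (simp add: sum_mset_distrib_right case_prod_unfold scalar_mult scalar_mult_right)
  moreover have "\<mu> ((b - scalar G c 1) * x) = \<mu> (b * x) - c * \<mu> x" for b c x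
    using assms scalar_mult[of c 1 x, symmetric]
    by (simp add: left_diff_distrib additive.diff[OF linear_form_additive] linear_form_scalar)
  ultimately show "commutator (dist_action G \<mu>) ((*) f) g = (\<Sum>(a, b)\<in>#comult G f.
      a * dist_action G (\<lambda>x. \<mu> ((b - scalar G (counit G b) 1) * x)) g)"
    by (simp add: commutator_def dist_action_mult[OF assms] dist_action_diff_form
        case_prod_unfold right_diff_distrib sum_mset_subtractf)
qed

text \<open>Translating \<mu> by an element of the augmentation ideal lowers by one the power of the
  ideal that it must kill, just as a commutator lowers the index.\<close>

lemma diff_op_dist_action:
  assumes "linear_form \<mu>" and "\<And>f. f \<in> ideal_power (ideal_at_identity G) n \<Longrightarrow> \<mu> f = 0"
  shows "diff_op n (dist_action G \<mu>)"
  using assms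
proof (induction n arbitrary: \<mu>)
  case 0
  then show ?case
    by (simp add: dist_action_def contract_right_def fun_eq_iff case_prod_unfold)
next
  case (Suc n)
  interpret R: module "(*) :: 'a \<Rightarrow> 'a \<Rightarrow> 'a" by (rule module_times)
  have "diff_op n (dist_action G (\<lambda>x. \<mu> ((b - scalar G (counit G b) 1) * x)))" for b
  proof (rule Suc.IH)
    fix x assume "x \<in> ideal_power (ideal_at_identity G) n"
    moreover have "b - scalar G (counit G b) 1 \<in> ideal_at_identity G"
      using counit_linear
      by (simp add: ideal_at_identity_def additive.diff[OF linear_form_additive]
          linear_form_scalar counit_one)
    ultimately show "\<mu> ((b - scalar G (counit G b) 1) * x) = 0"
      by (intro Suc.prems(2)) (auto intro: R.span_base)
  qed (rule linear_form_translate[OF Suc.prems(1)])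
  then show ?case
    by (auto simp: commutator_dist_action[OF Suc.prems(1)] case_prod_unfold
        dist_action_add[OF Suc.prems(1)] intro!: additive.intro diff_op_sum_mset diff_op_mult_left)
qed

text \<open>For f in the augmentation ideal, P(f g) = [P, f] g + f P(g), and the counit kills the
  second term; the first is left to the induction.\<close>

lemma counit_diff_op:
  assumes "diff_op n P" and "f \<in> ideal_power (ideal_at_identity G) n"
  shows "counit G (P f) = 0"
  using assms
proof (induction n arbitrary: P f)
  case 0
  then show ?case
    by (simp add: additive.zero[OF linear_form_additive[OF counit_linear]])
next
  case (Suc n)
  interpret R: module "(*) :: 'a \<Rightarrow> 'a \<Rightarrow> 'a" by (rule module_times)
  note counit_add = additive.add[OF linear_form_additive[OF counit_linear]]
  have "counit G (P x) = 0"
    if "x \<in> R.span {f * g | f g. f \<in> ideal_at_identity G \<and> g \<in> ideal_power (ideal_at_identity G) n}"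
    for x
    using that
  proof (induction x rule: R.span_induct_alt)
    case base
    then show ?case
      by (simp add: additive.zero[OF diff_op_additive[OF Suc.prems(1)]]
          additive.zero[OF linear_form_additive[OF counit_linear]])
  next
    case (step c x y)
    then obtain f g where x: "x = f * g" and f: "counit G f = 0"
      and g: "g \<in> ideal_power (ideal_at_identity G) n"
      by (auto simp: ideal_at_identity_def)
    \<comment> \<open>The span has ring coefficients; Q absorbs the coefficient c without raising
      the index.\<close>
    define Q where "Q = (\<lambda>x. P (c * x))"
    have "diff_op n (commutator Q ((*) f))"
      using diff_op_mult_right[OF Suc.prems(1), of c] by (simp add: Q_def)
    from Suc.IH[OF this g] have "counit G (commutator Q ((*) f) g) = 0" .
    moreover have "Q x = commutator Q ((*) f) g + f * Q g"
      by (simp add: commutator_def x)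
    ultimately have "counit G (Q x) = 0"
      by (simp add: counit_add counit_mult f)
    with step show ?case
      by (simp add: Q_def additive.add[OF diff_op_additive[OF Suc.prems(1)]] counit_add)
  qed
  with Suc.prems show ?case by simp
qed

section \<open>Powers in the distribution algebra\<close>

lemma linear_form_funpow:
  assumes "linear_form \<mu>"
  shows "linear_form (\<lambda>f. counit G ((dist_action G \<mu> ^^ n) f))"
proof (induction n)
  case 0
  then show ?case using counit_linear by simp
next
  case (Suc n)
  then show ?case
    unfolding funpow_Suc_right comp_def
    using assms by (simp add: linear_form_iff dist_action_add[OF assms] dist_action_scalar[OF assms])
qed

lemma Dist_algebra_pow:
  assumes "linear_form \<mu>"
  shows "\<mu> [^]\<^bsub>Dist_algebra G\<^esub> n = (\<lambda>f. counit G ((dist_action G \<mu> ^^ n) f))"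
proof (induction n)
  case 0
  then show ?case by (simp add: Dist_algebra_def)
next
  case (Suc n)
  define \<nu> where "\<nu> = (\<lambda>f. counit G ((dist_action G \<mu> ^^ n) f))"
  have \<nu>: "linear_form \<nu>" unfolding \<nu>_def by (rule linear_form_funpow[OF assms])
  \<comment> \<open>The monoid power multiplies by \<mu> on the right, so each new factor enters as
    the innermost \<open>T\<^sub>\<mu>\<close>.\<close>
  have "tensor_map \<nu> \<mu> (comult G f) = \<nu> (dist_action G \<mu> f)" for f
    by (simp add: tensor_map_def dist_action_def contract_right_def case_prod_unfold
        additive_sum_mset[OF linear_form_additive[OF \<nu>]] linear_form_scalar[OF \<nu>] mult.commute)
  then have "\<mu> [^]\<^bsub>Dist_algebra G\<^esub> Suc n = (\<lambda>f. \<nu> (dist_action G \<mu> f))"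
    using Suc.IH unfolding \<nu>_def[symmetric] by (simp add: Dist_algebra_def)
  then show ?case
    by (simp add: \<nu>_def funpow_swap1)
qed

end

theorem lemma3p2p1:
  fixes G :: "('k::alg_closed_field, 'a::comm_ring_1) coordinate_algebra"
    and p k :: nat and \<delta> :: "'a \<Rightarrow> 'k"
  assumes "affine_algebraic_group G"
    and "CHAR('k) = p" and "p > 0"
    and "k \<ge> 1"
    and "\<delta> \<in> Dist_plus G k"
  shows "\<delta> [^]\<^bsub>Dist_algebra G\<^esub> p \<in> Dist_plus G (p * k - 1)"
proof -
  interpret affine_algebraic_group G by fact
  define D where "D = dist_action G \<delta>"
  have lin: "linear_form \<delta>" and one: "\<delta> 1 = 0"
    and van: "\<And>f. f \<in> ideal_power (ideal_at_identity G) (Suc k) \<Longrightarrow> \<delta> f = 0"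
    using assms(5) by (auto simp: Dist_plus_def Dist_def simp del: ideal_power.simps)
  \<comment> \<open>The structure map from the field carries p = 0 over to the coordinate
    algebra.\<close>
  have "scalar G (of_nat n) 1 = of_nat n" for n
    by (induction n) (simp_all add: V.scale_left_distrib)
  from this[of p] have "of_nat p = (0 :: 'a)"
    using assms(2) of_nat_CHAR[where 'a = 'k] by simp
  then have "diff_op (p * k) (D ^^ p)"
    using diff_op_funpow_char[OF diff_op_dist_action[OF lin van], of k p] assms(3,4)
    by (simp only: D_def)
  note van_pow = counit_diff_op[OF this]
  have "(D ^^ p) 1 = 0"
  proof -
    have "(D ^^ n) 0 = 0" for n
      by (induction n) (simp_all add: D_def additive.zero[OF additive.intro] dist_action_add[OF lin])
    moreover have "D 1 = 0" by (simp add: D_def dist_action_one[OF lin] one)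
    moreover obtain n where "p = Suc n" using assms(3) by (cases p) auto
    ultimately show ?thesis by (simp add: funpow_swap1)
  qed
  \<comment> \<open>\<open>Dist G j\<close> tests the ideal power j + 1; since pk is positive, the
    subtraction is not truncated.\<close>
  moreover have "p * k - 1 + 1 = p * k" using assms(3,4) by simp
  ultimately show ?thesis
    using van_pow linear_form_funpow[OF lin, of p]
    by (simp add: Dist_plus_def Dist_def Dist_algebra_pow[OF lin] D_def
        additive.zero[OF linear_form_additive[OF counit_linear]] del: ideal_power.simps)
qed

end
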